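(* CCS is strongly replacement free: for every CCS context $C$, every invisible CCS process $I$ and every CCS process $P$, if $C[I]\Downarrow$ then $C[P]\Downarrow$.
   Context: CCS is Milner's Calculus of Communicating Systems with its standard labelled transition semantics (actions are names $a$, co-names $\overline{a}$, which are visible, and the invisible action $\tau$). A context is a term with one hole $[\cdot]$; $C[P]$ is the result of filling the hole with $P$. $\Rightarrow$ is the reflexive-transitive closure of $\xrightarrow{\tau}$. $P\Downarrow$ iff there exist a visible action $\alpha$ and $P'$ with $P\Rightarrow\xrightarrow{\alpha}\Rightarrow P'$; $P$ is invisible iff not $P\Downarrow$. *)

theory Defs
  imports Main
begin

text \<open>
  Milner's CCS. The type parameters are the names \<^typ>\<open>'a\<close>, the agent constants \<^typ>\<open>'c\<close>, the
  indices of summations \<^typ>\<open>'i\<close> and the process variables \<^typ>\<open>'x\<close>. Recursion is available in both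
  of Milner's forms: agent constants with defining equations, and recursion expressions
  \<open>fix X. E\<close>. Only the latter lets the hole of a context occur inside a recursion.
\<close>

datatype 'a label = Name 'a | Coname 'a

datatype 'a act = Vis "'a label" | Tau

fun co :: "'a label \<Rightarrow> 'a label" where
  "co (Name a) = Coname a"
| "co (Coname a) = Name a"

fun name_of :: "'a label \<Rightarrow> 'a" where
  "name_of (Name a) = a"
| "name_of (Coname a) = a"

text \<open>
  A relabelling is a function on labels that commutes with \<^const>\<open>co\<close>, extended by
  \<open>\<tau> \<mapsto> \<tau>\<close>. Such a function is determined by its values on the names, which are arbitrary
  labels; this is how it is represented in terms.
\<close>

fun relabel_label :: "('a \<Rightarrow> 'a label) \<Rightarrow> 'a label \<Rightarrow> 'a label" where
  "relabel_label f (Name a) = f a"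
| "relabel_label f (Coname a) = co (f a)"

fun relabel :: "('a \<Rightarrow> 'a label) \<Rightarrow> 'a act \<Rightarrow> 'a act" where
  "relabel f (Vis l) = Vis (relabel_label f l)"
| "relabel f Tau = Tau"

text \<open>
  \<open>Sum J E\<close> is the sum of the \<open>E j\<close> with \<open>j \<in> J\<close>; the values of \<open>E\<close> outside \<open>J\<close> are
  irrelevant, and the inactive process is the empty sum. \<open>Res E L\<close> restricts the names
  in \<open>L\<close> together with their co-names.
\<close>

datatype ('a, 'c, 'i, 'x) ccs =
    Var 'x
  | Const 'c
  | Prefix "'a act" "('a, 'c, 'i, 'x) ccs"
  | Sum "'i set" "'i \<Rightarrow> ('a, 'c, 'i, 'x) ccs"
  | Par "('a, 'c, 'i, 'x) ccs" "('a, 'c, 'i, 'x) ccs"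
  | Res "('a, 'c, 'i, 'x) ccs" "'a set"
  | Rel "('a, 'c, 'i, 'x) ccs" "'a \<Rightarrow> 'a label"
  | Fix 'x "('a, 'c, 'i, 'x) ccs"

primrec fv :: "('a, 'c, 'i, 'x) ccs \<Rightarrow> 'x set" where
  "fv (Var x) = {x}"
| "fv (Const A) = {}"
| "fv (Prefix \<alpha> E) = fv E"
| "fv (Sum J E) = (\<Union>j\<in>J. fv (E j))"
| "fv (Par E F) = fv E \<union> fv F"
| "fv (Res E L) = fv E"
| "fv (Rel E f) = fv E"
| "fv (Fix x E) = fv E - {x}"

definition process :: "('a, 'c, 'i, 'x) ccs \<Rightarrow> bool" where
  "process P \<longleftrightarrow> fv P = {}"

text \<open>
  \<open>subst x N E\<close> replaces the free occurrences of \<open>x\<close> in \<open>E\<close> by \<open>N\<close>. Bound variables are not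
  renamed: transitions are of interest for closed terms only, and there \<open>N\<close> is always closed.
\<close>

primrec subst :: "'x \<Rightarrow> ('a, 'c, 'i, 'x) ccs \<Rightarrow> ('a, 'c, 'i, 'x) ccs \<Rightarrow> ('a, 'c, 'i, 'x) ccs" where
  "subst x N (Var y) = (if x = y then N else Var y)"
| "subst x N (Const A) = Const A"
| "subst x N (Prefix \<alpha> E) = Prefix \<alpha> (subst x N E)"
| "subst x N (Sum J E) = Sum J (\<lambda>j. subst x N (E j))"
| "subst x N (Par E F) = Par (subst x N E) (subst x N F)"
| "subst x N (Res E L) = Res (subst x N E) L"
| "subst x N (Rel E f) = Rel (subst x N E) f"
| "subst x N (Fix y E) = (if x = y then Fix y E else Fix y (subst x N E))"

text \<open>The environment \<open>D\<close> maps each constant to the right-hand side of its defining equation.\<close>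

inductive lts ::
  "('c \<Rightarrow> ('a, 'c, 'i, 'x) ccs) \<Rightarrow> ('a, 'c, 'i, 'x) ccs \<Rightarrow> 'a act \<Rightarrow> ('a, 'c, 'i, 'x) ccs \<Rightarrow> bool"
  for D where
  Act:  "lts D (Prefix \<alpha> P) \<alpha> P"
| Sum:  "j \<in> J \<Longrightarrow> lts D (P j) \<alpha> P' \<Longrightarrow> lts D (Sum J P) \<alpha> P'"
| Com1: "lts D P \<alpha> P' \<Longrightarrow> lts D (Par P Q) \<alpha> (Par P' Q)"
| Com2: "lts D Q \<alpha> Q' \<Longrightarrow> lts D (Par P Q) \<alpha> (Par P Q')"
| Com3: "lts D P (Vis l) P' \<Longrightarrow> lts D Q (Vis (co l)) Q' \<Longrightarrow> lts D (Par P Q) Tau (Par P' Q')"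
| Res:  "lts D P \<alpha> P' \<Longrightarrow> (\<And>l. \<alpha> = Vis l \<Longrightarrow> name_of l \<notin> L) \<Longrightarrow> lts D (Res P L) \<alpha> (Res P' L)"
| Rel:  "lts D P \<alpha> P' \<Longrightarrow> lts D (Rel P f) (relabel f \<alpha>) (Rel P' f)"
| Con:  "lts D (D A) \<alpha> P' \<Longrightarrow> lts D (Const A) \<alpha> P'"
| Fix:  "lts D (subst x (Fix x E) E) \<alpha> P' \<Longrightarrow> lts D (Fix x E) \<alpha> P'"

definition weak ::
  "('c \<Rightarrow> ('a, 'c, 'i, 'x) ccs) \<Rightarrow> ('a, 'c, 'i, 'x) ccs \<Rightarrow> ('a, 'c, 'i, 'x) ccs \<Rightarrow> bool" where
  "weak D = (\<lambda>P P'. lts D P Tau P')\<^sup>*\<^sup>*"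

definition observable :: "('c \<Rightarrow> ('a, 'c, 'i, 'x) ccs) \<Rightarrow> ('a, 'c, 'i, 'x) ccs \<Rightarrow> bool" where
  "observable D P \<longleftrightarrow>
     (\<exists>l P\<^sub>1 P\<^sub>2 P'. weak D P P\<^sub>1 \<and> lts D P\<^sub>1 (Vis l) P\<^sub>2 \<and> weak D P\<^sub>2 P')"

definition invisible :: "('c \<Rightarrow> ('a, 'c, 'i, 'x) ccs) \<Rightarrow> ('a, 'c, 'i, 'x) ccs \<Rightarrow> bool" where
  "invisible D P \<longleftrightarrow> \<not> observable D P"

text \<open>
  Contexts with exactly one hole. In \<open>CSum j C J E\<close> the hole is in the \<open>j\<close>-th summand, the
  remaining summands being the \<open>E k\<close> with \<open>k \<in> J - {j}\<close>.
\<close>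

datatype ('a, 'c, 'i, 'x) ctx =
    Hole
  | CPrefix "'a act" "('a, 'c, 'i, 'x) ctx"
  | CSum 'i "('a, 'c, 'i, 'x) ctx" "'i set" "'i \<Rightarrow> ('a, 'c, 'i, 'x) ccs"
  | CPar1 "('a, 'c, 'i, 'x) ctx" "('a, 'c, 'i, 'x) ccs"
  | CPar2 "('a, 'c, 'i, 'x) ccs" "('a, 'c, 'i, 'x) ctx"
  | CRes "('a, 'c, 'i, 'x) ctx" "'a set"
  | CRel "('a, 'c, 'i, 'x) ctx" "'a \<Rightarrow> 'a label"
  | CFix 'x "('a, 'c, 'i, 'x) ctx"

primrec fill :: "('a, 'c, 'i, 'x) ctx \<Rightarrow> ('a, 'c, 'i, 'x) ccs \<Rightarrow> ('a, 'c, 'i, 'x) ccs" where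
  "fill Hole P = P"
| "fill (CPrefix \<alpha> C) P = Prefix \<alpha> (fill C P)"
| "fill (CSum j C J E) P = Sum (insert j J) (E(j := fill C P))"
| "fill (CPar1 C E) P = Par (fill C P) E"
| "fill (CPar2 E C) P = Par E (fill C P)"
| "fill (CRes C L) P = Res (fill C P) L"
| "fill (CRel C f) P = Rel (fill C P) f"
| "fill (CFix x C) P = Fix x (fill C P)"

primrec fv_ctx :: "('a, 'c, 'i, 'x) ctx \<Rightarrow> 'x set" where
  "fv_ctx Hole = {}"
| "fv_ctx (CPrefix \<alpha> C) = fv_ctx C"
| "fv_ctx (CSum j C J E) = fv_ctx C \<union> (\<Union>k\<in>J - {j}. fv (E k))"
| "fv_ctx (CPar1 C E) = fv_ctx C \<union> fv E"
| "fv_ctx (CPar2 E C) = fv E \<union> fv_ctx C"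
| "fv_ctx (CRes C L) = fv_ctx C"
| "fv_ctx (CRel C f) = fv_ctx C"
| "fv_ctx (CFix x C) = fv_ctx C - {x}"

definition process_context :: "('a, 'c, 'i, 'x) ctx \<Rightarrow> bool" where
  "process_context C \<longleftrightarrow> fv_ctx C = {}"

lemma fv_fill: "process P \<Longrightarrow> fv (fill C P) = fv_ctx C"
  by (induction C) (auto simp: process_def split: if_splits)

lemma process_fill_iff: "process P \<Longrightarrow> process (fill C P) \<longleftrightarrow> process_context C"
  by (simp add: fv_fill process_def [of "fill C P"] process_context_def)

definition strongly_replacement_free :: "('c \<Rightarrow> ('a, 'c, 'i, 'x) ccs) \<Rightarrow> bool" where
  "strongly_replacement_free D \<longleftrightarrow>
     (\<forall>C I P. process_context C \<longrightarrow> process I \<longrightarrow> invisible D I \<longrightarrow> process P \<longrightarrow>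
        observable D (fill C I) \<longrightarrow> observable D (fill C P))"

end

theory Submission
  imports Defs
begin

text \<open>
  The terms \<open>C[I]\<close> and \<open>C[P]\<close> are related by a simulation in which a silent step may also be
  answered by no step at all. It relates every invisible process to every process and is closed
  under the operators. Visible actions, hence also both halves of a communication, never come from
  an invisible component and are answered exactly; a silent step of an invisible component is
  ignored. Ignoring such a step below a sum or a recursion leaves the sum or recursion in place on
  the right, although it has been resolved on the left. Therefore the right-hand side may also be
  replaced by any process that strongly simulates it.
\<close>

section \<open>Free variables under substitution and transitions\<close>

lemma subst_fv: "fv (subst x N E) \<subseteq> (fv E - {x}) \<union> fv N"
  by (induction E) (auto split: if_splits)

lemma fv_subst_fresh: "x \<notin> fv E \<Longrightarrow> fv (subst x N E) = fv E"
  by (induction E) auto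

lemma process_subst: "process E \<Longrightarrow> process (subst x N E)"
  by (simp add: process_def fv_subst_fresh)

text \<open>Unfolding \<open>Fix x E\<close> brings back only free variables of
  \<open>Fix x E\<close> itself, and unfolding a constant yields a closed term because the
  right-hand sides of the defining equations are closed.\<close>

lemma lts_fv:
  assumes "lts D E \<alpha> E'" and "\<forall>A. process (D A)"
  shows "fv E' \<subseteq> fv E"
  using assms(1)
proof induction
  case (Con A \<alpha> P')
  then show ?case using assms(2) by (simp add: process_def)
next
  case (Fix x E \<alpha> P')
  then show ?case using subst_fv [of x "Fix x E" E] by auto
qed auto

lemma lts_process:
  assumes "lts D E \<alpha> E'" and "\<forall>A. process (D A)" and "process E"
  shows "process E'"
  using lts_fv [OF assms(1,2)] assms(3) by (simp add: process_def)

section \<open>Terms up to irrelevant summands\<close>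

text \<open>
  Substitution for a variable that is not free in a term can still change the irrelevant summands
  \<open>E j\<close> with \<open>j \<notin> J\<close> of \<open>Sum J E\<close>. Pruning forgets these.
\<close>

primrec prune :: "('a, 'c, 'i, 'x) ccs \<Rightarrow> ('a, 'c, 'i, 'x) ccs" where
  "prune (Var x) = Var x"
| "prune (Const A) = Const A"
| "prune (Prefix \<alpha> E) = Prefix \<alpha> (prune E)"
| "prune (Sum J E) = Sum J (\<lambda>j. if j \<in> J then prune (E j) else Const undefined)"
| "prune (Par E F) = Par (prune E) (prune F)"
| "prune (Res E L) = Res (prune E) L"
| "prune (Rel E f) = Rel (prune E) f"
| "prune (Fix x E) = Fix x (prune E)"

lemma prune_subst: "prune (subst x N E) = subst x (prune N) (prune E)"
  by (induction E) auto

lemma prune_subst_fresh: "x \<notin> fv E \<Longrightarrow> prune (subst x N E) = prune E"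
  by (induction E) (auto simp: fun_eq_iff)

lemma prune_eq_iff:
  "Prefix \<alpha> E' = prune F \<longleftrightarrow> (\<exists>G. F = Prefix \<alpha> G \<and> E' = prune G)"
  "Const A = prune F \<longleftrightarrow> F = Const A"
  "Par E' E'' = prune F \<longleftrightarrow> (\<exists>G H. F = Par G H \<and> E' = prune G \<and> E'' = prune H)"
  "Res E' L = prune F \<longleftrightarrow> (\<exists>G. F = Res G L \<and> E' = prune G)"
  "Rel E' f = prune F \<longleftrightarrow> (\<exists>G. F = Rel G f \<and> E' = prune G)"
  "Fix x E' = prune F \<longleftrightarrow> (\<exists>G. F = Fix x G \<and> E' = prune G)"
  by (cases F; auto)+

lemma prune_Sum_eqE:
  assumes "prune (Sum J E) = prune F"
  obtains G where "F = Sum J G" and "\<And>j. j \<in> J \<Longrightarrow> prune (E j) = prune (G j)"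
proof (cases F)
  case (Sum K G)
  then show ?thesis using assms that by (auto simp: fun_eq_iff) metis
qed (use assms in simp_all)

text \<open>Transitions of a sum come only from summands inside the index set, which pruning keeps.
  For a recursion, pruning commutes with the unfolding by \<open>prune_subst\<close>.\<close>

lemma prune_simulation:
  "lts D E \<alpha> E' \<Longrightarrow> prune E = prune F \<Longrightarrow> \<exists>F'. lts D F \<alpha> F' \<and> prune E' = prune F'"
proof (induction arbitrary: F rule: lts.induct)
  case (Sum j J P \<alpha> P')
  then show ?case by (metis prune_Sum_eqE lts.Sum)
next
  case (Fix x E \<alpha> P')
  then obtain G where G: "F = Fix x G" "prune E = prune G"
    by (auto simp: prune_eq_iff)
  then have "prune (subst x (Fix x E) E) = prune (subst x (Fix x G) G)"
    by (simp add: prune_subst)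
  with Fix.IH G show ?case by (metis lts.Fix)
next
  case (Con A \<alpha> P')
  then show ?case by (metis prune.simps(2) prune_eq_iff(2) lts.Con)
next
  case (Act \<alpha> P)
  then show ?case by (auto simp: prune_eq_iff intro: lts.Act)
next
  case (Com1 P \<alpha> P' Q)
  then obtain G H where "F = Par G H" "prune P = prune G" "prune Q = prune H"
    by (auto simp: prune_eq_iff)
  with Com1.IH show ?case by (metis prune.simps(5) lts.Com1)
next
  case (Com2 Q \<alpha> Q' P)
  then obtain G H where "F = Par G H" "prune P = prune G" "prune Q = prune H"
    by (auto simp: prune_eq_iff)
  with Com2.IH show ?case by (metis prune.simps(5) lts.Com2)
next
  case (Com3 P l P' Q Q')
  then obtain G H where "F = Par G H" "prune P = prune G" "prune Q = prune H"
    by (auto simp: prune_eq_iff)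
  with Com3.IH show ?case by (metis prune.simps(5) lts.Com3)
next
  case (Res P \<alpha> P' L)
  then obtain G where "F = Res G L" "prune P = prune G"
    by (auto simp: prune_eq_iff)
  with Res.IH Res.hyps(2) show ?case by (metis prune.simps(6) lts.Res)
next
  case (Rel P \<alpha> P' f)
  then obtain G where "F = Rel G f" "prune P = prune G"
    by (auto simp: prune_eq_iff)
  with Rel.IH show ?case by (metis prune.simps(7) lts.Rel)
qed

section \<open>Strong similarity\<close>

coinductive ssim ::
  "('c \<Rightarrow> ('a, 'c, 'i, 'x) ccs) \<Rightarrow> ('a, 'c, 'i, 'x) ccs \<Rightarrow> ('a, 'c, 'i, 'x) ccs \<Rightarrow> bool"
  for D where
  "(\<And>\<alpha> P'. lts D P \<alpha> P' \<Longrightarrow> \<exists>Q'. lts D Q \<alpha> Q' \<and> ssim D P' Q') \<Longrightarrow> ssim D P Q"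

lemma ssimD: "ssim D P Q \<Longrightarrow> lts D P \<alpha> P' \<Longrightarrow> \<exists>Q'. lts D Q \<alpha> Q' \<and> ssim D P' Q'"
  by (blast elim: ssim.cases)

lemma prune_eq_imp_ssim:
  assumes "prune P = prune Q"
  shows "ssim D P Q"
  using assms
proof (coinduction arbitrary: P Q)
  case ssim
  have "\<exists>Q'. lts D Q \<alpha> Q' \<and> (prune P' = prune Q' \<or> ssim D P' Q')" if "lts D P \<alpha> P'" for \<alpha> P'
    using prune_simulation [OF that ssim] by auto
  then show ?case by auto
qed

lemma ssim_refl: "ssim D P P"
  by (rule prune_eq_imp_ssim) simp

lemma ssim_trans:
  assumes "ssim D P Q" and "ssim D Q R"
  shows "ssim D P R"
  using assms
proof (coinduction arbitrary: P Q R)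
  case ssim
  have "\<exists>R'. lts D R \<alpha> R' \<and> (\<exists>Q'. ssim D P' Q' \<and> ssim D Q' R')" if "lts D P \<alpha> P'" for \<alpha> P'
    using ssimD [OF ssim(1) that] ssimD [OF ssim(2)] by meson
  then show ?case by fastforce
qed

text \<open>Serves to compare a summand with its sum, or an unfolding with its recursion. The
  targets coincide, so reflexivity of \<open>ssim\<close> suffices after one step.\<close>

lemma ssim_lts_subset: "(\<And>\<alpha> P'. lts D P \<alpha> P' \<Longrightarrow> lts D Q \<alpha> P') \<Longrightarrow> ssim D P Q"
  by (blast intro: ssim.intros ssim_refl)

text \<open>In a closed term substitution can alter only irrelevant summands, so both terms have the
  same pruning.\<close>

lemma ssim_subst:
  assumes "process P"
  shows "ssim D P (subst x N P)" and "ssim D (subst x N P) P"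
  using assms by (auto intro!: prune_eq_imp_ssim simp: prune_subst_fresh process_def)

section \<open>Weak transitions, observability and invisibility\<close>

lemma weak_refl: "weak D P P"
  by (simp add: weak_def)

lemma weak_step: "weak D P Q \<Longrightarrow> lts D Q Tau R \<Longrightarrow> weak D P R"
  unfolding weak_def by (rule rtranclp.rtrancl_into_rtrancl)

lemma step_weak: "lts D P Tau Q \<Longrightarrow> weak D Q R \<Longrightarrow> weak D P R"
  unfolding weak_def by (rule converse_rtranclp_into_rtranclp)

lemma weak_induct [consumes 1, case_names refl step]:
  assumes "weak D P Q" and "\<phi> P"
    and "\<And>Q R. weak D P Q \<Longrightarrow> lts D Q Tau R \<Longrightarrow> \<phi> Q \<Longrightarrow> \<phi> R"
  shows "\<phi> Q"
  using assms(1) unfolding weak_def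
  by (induction rule: rtranclp_induct) (use assms(2,3) in \<open>auto simp: weak_def\<close>)

lemma observable_iff: "observable D P \<longleftrightarrow> (\<exists>l P\<^sub>1 P\<^sub>2. weak D P P\<^sub>1 \<and> lts D P\<^sub>1 (Vis l) P\<^sub>2)"
  unfolding observable_def using weak_refl by blast

lemma ssim_weak:
  assumes "weak D P P'" and "ssim D P Q"
  shows "\<exists>Q'. weak D Q Q' \<and> ssim D P' Q'"
  using assms(1)
proof (induction rule: weak_induct)
  case refl
  show ?case using assms(2) weak_refl by blast
next
  case (step P' P'')
  then obtain Q' where Q': "weak D Q Q'" "ssim D P' Q'" by blast
  from ssimD [OF Q'(2) step.hyps(2)] Q'(1) show ?case using weak_step by blast
qed

lemma ssim_observable: "ssim D P Q \<Longrightarrow> observable D P \<Longrightarrow> observable D Q"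
  unfolding observable_iff by (meson ssim_weak ssimD)

lemma invisible_subst: "process P \<Longrightarrow> invisible D P \<Longrightarrow> invisible D (subst x N P)"
  unfolding invisible_def by (metis ssim_observable ssim_subst(2))

text \<open>A visible step would itself be an observation, and a silent step can be put in front of
  any observation of its target.\<close>

lemma invisible_lts:
  assumes "invisible D P" and "lts D P \<alpha> P'"
  shows "\<alpha> = Tau" and "invisible D P'"
proof -
  show tau: "\<alpha> = Tau"
  proof (cases \<alpha>)
    case (Vis l)
    with assms(2) have "observable D P" unfolding observable_iff using weak_refl by blast
    with assms(1) show ?thesis by (simp add: invisible_def)
  qed
  have "observable D P" if "observable D P'"
    using that step_weak [OF assms(2) [unfolded tau]] unfolding observable_iff by blast
  with assms(1) show "invisible D P'" by (auto simp: invisible_def)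
qed

section \<open>The replacement relation\<close>

text \<open>
  On open terms only the identity is admitted, because \<^const>\<open>ssim\<close> is not stable under substitution
  there: a variable has no transitions.
\<close>

definition below ::
  "('c \<Rightarrow> ('a, 'c, 'i, 'x) ccs) \<Rightarrow> ('a, 'c, 'i, 'x) ccs \<Rightarrow> ('a, 'c, 'i, 'x) ccs \<Rightarrow> bool" where
  "below D E F \<longleftrightarrow> E = F \<or> process E \<and> process F \<and> ssim D E F"

lemma below_refl [simp]: "below D E E"
  by (simp add: below_def)

lemma below_trans: "below D E F \<Longrightarrow> below D F G \<Longrightarrow> below D E G"
  unfolding below_def using ssim_trans by blast

lemma below_process: "below D E F \<Longrightarrow> process F \<Longrightarrow> process E"
  by (auto simp: below_def)

text \<open>A closed term and its substitution instance simulate each other, so transitivity carries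
  similarity over; equal terms stay equal.\<close>

lemma below_subst: "below D E F \<Longrightarrow> below D (subst x N E) (subst x N F)"
  unfolding below_def by (metis process_subst ssim_subst ssim_trans)

text \<open>Building \<open>below\<close> into the operator rules closes the relation on the right
  under similarity, while inversion still exposes the related components of the left-hand operator.
  \<open>Invisible\<close> accepts every process already, and a variable is \<open>below\<close>
  only itself.\<close>

inductive replaced ::
  "('c \<Rightarrow> ('a, 'c, 'i, 'x) ccs) \<Rightarrow> ('a, 'c, 'i, 'x) ccs \<Rightarrow> ('a, 'c, 'i, 'x) ccs \<Rightarrow> bool"
  for D where
  Invisible: "invisible D I \<Longrightarrow> process I \<Longrightarrow> process P \<Longrightarrow> replaced D I P"
| Var: "replaced D (Var x) (Var x)"
| Const: "below D (Const A) H \<Longrightarrow> replaced D (Const A) H"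
| Prefix: "replaced D E F \<Longrightarrow> below D (Prefix \<alpha> F) H \<Longrightarrow> replaced D (Prefix \<alpha> E) H"
| Sum: "(\<And>j. j \<in> J \<Longrightarrow> replaced D (E j) (F j)) \<Longrightarrow> below D (Sum J F) H \<Longrightarrow> replaced D (Sum J E) H"
| Par: "replaced D E F \<Longrightarrow> replaced D E' F' \<Longrightarrow> below D (Par F F') H \<Longrightarrow> replaced D (Par E E') H"
| Res: "replaced D E F \<Longrightarrow> below D (Res F L) H \<Longrightarrow> replaced D (Res E L) H"
| Rel: "replaced D E F \<Longrightarrow> below D (Rel F f) H \<Longrightarrow> replaced D (Rel E f) H"
| Fix: "replaced D E F \<Longrightarrow> below D (Fix x F) H \<Longrightarrow> replaced D (Fix x E) H"

lemmas replaced_congs = replaced.Const [OF below_refl] replaced.Prefix [OF _ below_refl]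
  replaced.Sum [OF _ below_refl] replaced.Par [OF _ _ below_refl] replaced.Res [OF _ below_refl]
  replaced.Rel [OF _ below_refl] replaced.Fix [OF _ below_refl]

lemma replaced_refl: "replaced D E E"
  by (induction E) (auto intro: replaced.Var replaced_congs)

lemma replaced_fill:
  assumes "replaced D I P"
  shows "replaced D (fill C I) (fill C P)"
  using assms by (induction C) (auto intro!: replaced_congs replaced_refl)

lemma replaced_below: "replaced D E F \<Longrightarrow> below D F G \<Longrightarrow> replaced D E G"
proof (induction rule: replaced.induct)
  case (Invisible I P)
  then show ?case by (metis below_def replaced.Invisible)
next
  case (Var x)
  then have "G = Var x" by (simp add: below_def process_def)
  then show ?case by (simp add: replaced.Var)
qed (blast intro: replaced.intros below_trans)+

text \<open>Unfolding related recursions substitutes different but related terms for the variable.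
  The \<open>below\<close> part of each operator rule survives by
  \<open>below_subst\<close>.\<close>

lemma replaced_subst:
  assumes "replaced D E F" and "replaced D N M"
  shows "replaced D (subst x N E) (subst x M F)"
  using assms(1)
proof induction
  case (Invisible I P)
  \<comment> \<open>Both terms are closed, so substitution affects only irrelevant summands and
    invisibility is kept.\<close>
  then show ?case by (simp add: invisible_subst process_subst replaced.Invisible)
next
  case (Var y)
  then show ?case using assms(2) by (simp add: replaced.Var)
next
  case (Const A H)
  then show ?case using below_subst [of D "Const A" H x M] by (simp add: replaced.Const)
next
  case (Prefix E F \<alpha> H)
  then show ?case using below_subst [of D "Prefix \<alpha> F" H x M] by (auto intro: replaced.Prefix)
next
  case (Sum J E F H)
  then show ?case using below_subst [of D "Sum J F" H x M]
    by (auto intro: replaced.Sum [where F = "\<lambda>j. subst x M (F j)"])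
next
  case (Par E F E' F' H)
  then show ?case using below_subst [of D "Par F F'" H x M] by (auto intro: replaced.Par)
next
  case (Res E F L H)
  then show ?case using below_subst [of D "Res F L" H x M] by (auto intro: replaced.Res)
next
  case (Rel E F f H)
  then show ?case using below_subst [of D "Rel F f" H x M] by (auto intro: replaced.Rel)
next
  case (Fix E F y H)
  then show ?case using below_subst [of D "Fix y F" H x M] by (auto intro: replaced.Fix)
qed

section \<open>Simulation of single steps\<close>

definition answered ::
  "('c \<Rightarrow> ('a, 'c, 'i, 'x) ccs) \<Rightarrow> 'a act \<Rightarrow> ('a, 'c, 'i, 'x) ccs \<Rightarrow> ('a, 'c, 'i, 'x) ccs \<Rightarrow> bool" where
  "answered D \<alpha> E' F \<longleftrightarrow>
     (\<exists>F'. lts D F \<alpha> F' \<and> replaced D E' F') \<or> \<alpha> = Tau \<and> replaced D E' F"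

text \<open>Distinct \<open>F\<close> and \<open>G\<close> are closed and similar. A matching step
  of \<open>F\<close> then becomes one of \<open>G\<close> whose closed target absorbs the
  difference by \<open>replaced_below\<close>; if the step is ignored, \<open>G\<close> itself does
  so.\<close>

lemma answered_below:
  assumes "\<forall>A. process (D A)" and "answered D \<alpha> E' F" and "below D F G"
  shows "answered D \<alpha> E' G"
proof (cases "F = G")
  case False
  with assms(3) have *: "process F" "process G" "ssim D F G"
    by (auto simp: below_def)
  from assms(2) consider F' where "lts D F \<alpha> F'" "replaced D E' F'" | "\<alpha> = Tau" "replaced D E' F"
    by (auto simp: answered_def)
  then show ?thesis
  proof cases
    case 1
    from ssimD [OF *(3) 1(1)] obtain G' where G': "lts D G \<alpha> G'" "ssim D F' G'" by blast
    then have "below D F' G'"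
      using lts_process [OF 1(1) assms(1) *(1)] lts_process [OF G'(1) assms(1) *(2)]
      by (simp add: below_def)
    then have "replaced D E' G'" using 1(2) replaced_below by blast
    with G'(1) show ?thesis by (auto simp: answered_def)
  next
    case 2
    with assms(3) show ?thesis by (simp add: answered_def replaced_below)
  qed
qed (use assms in simp)

text \<open>A matching step is copied. After an ignored step the left residual is related to
  \<open>F\<close>, not to the sum or recursion \<open>G\<close> from which \<open>F\<close> stems;
  inclusion of transitions gives \<open>below D F G\<close>, which moves the residual to
  \<open>G\<close>.\<close>

lemma answered_lts_subset:
  assumes "answered D \<alpha> E' F" and "process F" and "process G"
    and "\<And>\<beta> F'. lts D F \<beta> F' \<Longrightarrow> lts D G \<beta> F'"
  shows "answered D \<alpha> E' G"
proof -
  have "below D F G" using assms(2-4) by (auto simp: below_def intro: ssim_lts_subset)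
  with assms show ?thesis unfolding answered_def using replaced_below by blast
qed

text \<open>The step is silent and leads to an invisible process again, which is related to every
  process, so the right-hand side can stay at \<open>F\<close>.\<close>

lemma answered_invisible:
  assumes "\<forall>A. process (D A)" and "lts D E \<alpha> E'" and "invisible D E" and "process E" and "process F"
  shows "answered D \<alpha> E' F"
  using invisible_lts [OF assms(3,2)] lts_process [OF assms(2,1,4)] assms(5)
  by (simp add: answered_def replaced.Invisible)

text \<open>Induction on the derivation, inverting \<open>replaced\<close> in each case. A step of
  an invisible left-hand side is ignored; otherwise the term built from the related components
  answers first, and \<open>answered_below\<close> passes the answer on to \<open>H\<close>.\<close>

lemma replaced_simulation:
  assumes D: "\<forall>A. process (D A)"
  shows "lts D E \<alpha> E' \<Longrightarrow> replaced D E H \<Longrightarrow> process H \<Longrightarrow> answered D \<alpha> E' H"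
proof (induction arbitrary: H rule: lts.induct)
  case (Act \<alpha> P)
  from Act(1) show ?case
  proof cases
    case Invisible
    then show ?thesis using answered_invisible [OF D lts.Act] Act(2) by blast
  next
    case (Prefix F)
    then have "answered D \<alpha> P (Prefix \<alpha> F)" by (auto simp: answered_def intro: lts.Act)
    then show ?thesis using answered_below [OF D] Prefix by blast
  qed
next
  case (Sum j J P \<alpha> P')
  from Sum.prems(1) show ?case
  proof cases
    case Invisible
    moreover have "lts D (Sum J P) \<alpha> P'" using Sum.hyps by (rule lts.Sum)
    ultimately show ?thesis using answered_invisible [OF D] Sum.prems(2) by blast
  next
    case (Sum F)
    have closed: "process (Sum J F)" using Sum Sum.prems below_process by blast
    then have Fj: "process (F j)" using \<open>j \<in> J\<close> by (simp add: process_def)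
    then have "answered D \<alpha> P' (F j)" using Sum Sum.IH \<open>j \<in> J\<close> by blast
    then have "answered D \<alpha> P' (Sum J F)"
      using answered_lts_subset Fj closed lts.Sum \<open>j \<in> J\<close> by metis
    then show ?thesis using answered_below [OF D] Sum by blast
  qed
next
  case (Com1 P \<alpha> P' Q)
  from Com1.prems(1) show ?case
  proof cases
    case Invisible
    then show ?thesis using answered_invisible [OF D lts.Com1 [OF Com1.hyps]] Com1.prems(2) by blast
  next
    case (Par F F')
    then have "process F" using Com1.prems below_process by (fastforce simp: process_def)
    then have "answered D \<alpha> P' F" using Par Com1.IH by blast
    then have "answered D \<alpha> (Par P' Q) (Par F F')"
      using Par unfolding answered_def by (meson lts.Com1 replaced_congs(4))
    then show ?thesis using answered_below [OF D] Par by blast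
  qed
next
  case (Com2 Q \<alpha> Q' P)
  from Com2.prems(1) show ?case
  proof cases
    case Invisible
    then show ?thesis using answered_invisible [OF D lts.Com2 [OF Com2.hyps]] Com2.prems(2) by blast
  next
    case (Par F F')
    then have "process F'" using Com2.prems below_process by (fastforce simp: process_def)
    then have "answered D \<alpha> Q' F'" using Par Com2.IH by blast
    then have "answered D \<alpha> (Par P Q') (Par F F')"
      using Par unfolding answered_def by (meson lts.Com2 replaced_congs(4))
    then show ?thesis using answered_below [OF D] Par by blast
  qed
next
  case (Com3 P l P' Q Q')
  from Com3.prems(1) show ?case
  proof cases
    case Invisible
    then show ?thesis using answered_invisible [OF D lts.Com3 [OF Com3.hyps]] Com3.prems(2) by blast
  next
    case (Par F F')
    then have "process F" "process F'"
      using Com3.prems below_process by (fastforce simp: process_def)+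
    then have "answered D (Vis l) P' F" "answered D (Vis (co l)) Q' F'"
      using Par Com3.IH by blast+
    \<comment> \<open>Visible steps cannot be ignored, so both components move with complementary
      labels and can communicate on the right as well.\<close>
    then have "answered D Tau (Par P' Q') (Par F F')"
      unfolding answered_def by (meson act.distinct(1) lts.Com3 replaced_congs(4))
    then show ?thesis using answered_below [OF D] Par by blast
  qed
next
  case (Res P \<alpha> P' L)
  from Res.prems(1) show ?case
  proof cases
    case Invisible
    moreover have "lts D (Res P L) \<alpha> (Res P' L)" using Res.hyps by (rule lts.Res)
    ultimately show ?thesis using answered_invisible [OF D] Res.prems(2) by blast
  next
    case (Res F)
    then have "process F" using Res.prems below_process by (fastforce simp: process_def)
    then have "answered D \<alpha> P' F" using Res Res.IH by blast
    \<comment> \<open>A matching step carries the same action, so the side condition on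
      \<open>L\<close> also holds on the right.\<close>
    then have "answered D \<alpha> (Res P' L) (Res F L)"
      using Res.hyps(2) unfolding answered_def by (meson lts.Res replaced_congs(5))
    then show ?thesis using answered_below [OF D] Res by blast
  qed
next
  case (Rel P \<alpha> P' f)
  from Rel.prems(1) show ?case
  proof cases
    case Invisible
    then show ?thesis using answered_invisible [OF D lts.Rel [OF Rel.hyps]] Rel.prems(2) by blast
  next
    case (Rel F)
    then have "process F" using Rel.prems below_process by (fastforce simp: process_def)
    then have "answered D \<alpha> P' F" using Rel Rel.IH by blast
    \<comment> \<open>Relabelling fixes \<open>Tau\<close>, so an ignored step may still be
      ignored.\<close>
    then have "answered D (relabel f \<alpha>) (Rel P' f) (Rel F f)"
      unfolding answered_def by (metis lts.Rel relabel.simps(2) replaced_congs(6))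
    then show ?thesis using answered_below [OF D] Rel by blast
  qed
next
  case (Con A \<alpha> P')
  from Con.prems(1) show ?case
  proof cases
    case Invisible
    then show ?thesis using answered_invisible [OF D lts.Con [OF Con.hyps]] Con.prems(2) by blast
  next
    case Const
    have "answered D \<alpha> P' (Const A)"
      using lts.Con [OF Con.hyps] replaced_refl [of D P'] by (auto simp: answered_def)
    then show ?thesis using answered_below [OF D] Const by blast
  qed
next
  case (Fix x E \<alpha> P')
  from Fix.prems(1) show ?case
  proof cases
    case Invisible
    then show ?thesis using answered_invisible [OF D lts.Fix [OF Fix.hyps]] Fix.prems(2) by blast
  next
    case (Fix F)
    let ?F = "subst x (Fix x F) F"
    have closed: "process (Fix x F)" using Fix Fix.prems below_process by blast
    then have unfolded: "process ?F"
      using subst_fv [of x "Fix x F" F] by (auto simp: process_def)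
    \<comment> \<open>Related bodies receive related recursions, so the two unfoldings are
      related.\<close>
    have "replaced D (subst x (Fix x E) E) ?F"
      using Fix by (blast intro: replaced_subst replaced_congs(7))
    then have "answered D \<alpha> P' ?F" using Fix.IH unfolded by blast
    then have "answered D \<alpha> P' (Fix x F)"
      using answered_lts_subset unfolded closed lts.Fix by metis
    then show ?thesis using answered_below [OF D] Fix by blast
  qed
qed

section \<open>Weak simulation and transfer of observability\<close>

lemma replaced_weak:
  assumes D: "\<forall>A. process (D A)"
    and "weak D E E'" and "replaced D E F" and "process F"
  shows "\<exists>F'. weak D F F' \<and> replaced D E' F' \<and> process F'"
  using assms(2)
proof (induction rule: weak_induct)
  case refl
  show ?case using assms(3,4) weak_refl by blast
next
  case (step E' E'')
  then obtain F' where F': "weak D F F'" "replaced D E' F'" "process F'" by blast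
  with replaced_simulation [OF D step.hyps(2)] consider
    F'' where "lts D F' Tau F''" "replaced D E'' F''" | "replaced D E'' F'"
    by (auto simp: answered_def)
  then show ?case
  proof cases
    case 1
    moreover have "process F''" using lts_process [OF 1(1) D F'(3)] .
    ultimately show ?thesis using weak_step [OF F'(1)] by blast
  qed (use F' in blast)
qed

lemma replaced_observable:
  assumes D: "\<forall>A. process (D A)"
    and "observable D E" and "replaced D E F" and "process F"
  shows "observable D F"
proof -
  from assms(2) obtain l E\<^sub>1 E\<^sub>2 where "weak D E E\<^sub>1" and step: "lts D E\<^sub>1 (Vis l) E\<^sub>2"
    by (auto simp: observable_iff)
  then obtain F\<^sub>1 where F\<^sub>1: "weak D F F\<^sub>1" "replaced D E\<^sub>1 F\<^sub>1" "process F\<^sub>1"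
    using replaced_weak [OF D] assms(3,4) by blast
  then have "answered D (Vis l) E\<^sub>2 F\<^sub>1" using replaced_simulation [OF D step] by blast
  \<comment> \<open>For a visible action only the exact answer remains.\<close>
  with F\<^sub>1 show ?thesis by (auto simp: answered_def observable_iff)
qed

theorem theorem3p4:
  fixes D :: "'c \<Rightarrow> ('a, 'c, 'i, 'x) ccs"
  assumes "\<And>A. process (D A)"
  shows "strongly_replacement_free D"
  unfolding strongly_replacement_free_def
proof (intro allI impI)
  fix C :: "('a, 'c, 'i, 'x) ctx" and I P :: "('a, 'c, 'i, 'x) ccs"
  assume "process_context C" and "process I" and "invisible D I" and "process P"
    and "observable D (fill C I)"
  moreover from this have "process (fill C P)" by (simp add: process_fill_iff)
  moreover from assms have "\<forall>A. process (D A)" ..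
  ultimately show "observable D (fill C P)"
    using replaced_observable replaced_fill replaced.Invisible by metis
qed

end
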